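(* Let $Z=(Z_t)_{t\ge 0}$ be a real-valued Lévy process without Gaussian component, with characteristic exponent $\psi$ and Lévy measure $\mu$ satisfying $\mu(\mathbb{R})=\infty$. Suppose that condition A holds, i.e. there exists $\beta>1$ such that $\psi^U(\xi)\le \beta\,\psi^L(\xi)$ for all $\xi\in\mathbb{R}$. Then for every $t>0$ the distribution density $p_t$ of $Z_t$ exists and is infinitely differentiable, and for every $t_0>0$ there exist positive constants $c=c(t_0)$ and $d=d(t_0)$ such that $$c\,\rho_t\le \max_{x\in\mathbb{R}}p_t(x)\le d\,\rho_t,\qquad t\in(0,t_0].$$
   Context: The characteristic exponent $\psi$ is defined by $E e^{i\xi Z_t}=e^{-t\psi(\xi)}$, $\xi\in\mathbb{R}$, and has the Lévy–Khinchin representation $$\psi(\xi)=ia\xi+\int_{\mathbb{R}}\bigl(1-e^{i\xi u}+i\xi u\mathbf 1_{|u|<1}\bigr)\mu(du),$$ where $a\in\mathbb{R}$ and $\mu$ is a Lévy measure ($\mu(\{0\})=0$, $\int_{\mathbb{R}}(1\wedge u^2)\mu(du)<\infty$). Define, for $\xi\in\mathbb{R}$, $$\psi^L(\xi)=\int_{|\xi u|<1}(\xi u)^2\mu(du),\qquad \psi^U(\xi)=\int_{\mathbb{R}}\bigl((\xi u)^2\wedge 1\bigr)\mu(du).$$ For $t>0$ put $\rho_t:=\inf\{\xi>0:\ \mathrm{Re}\,\psi(\xi)\ge 1/t\}$ (the set is nonempty under condition A). *)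

theory Defs
  imports "HOL-Probability.Probability"
begin

definition cadlag :: "(real \<Rightarrow> real) \<Rightarrow> bool" where
  "cadlag f \<longleftrightarrow>
     (\<forall>t\<ge>0. continuous (at_right t) f) \<and> (\<forall>t>0. \<exists>l. (f \<longlongrightarrow> l) (at_left t))"

text \<open>Time runs over \<open>[0, \<infinity>)\<close>; the values of \<open>Z t\<close> for negative \<open>t\<close> are irrelevant.\<close>

locale levy_process = prob_space M
  for M :: "'a measure" and Z :: "real \<Rightarrow> 'a \<Rightarrow> real" +
  assumes random_variable_Z: "t \<ge> 0 \<Longrightarrow> random_variable borel (Z t)"
    and start_zero: "AE \<omega> in M. Z 0 \<omega> = 0"
    and indep_increments:
      "0 \<le> s 0 \<Longrightarrow> (\<And>i. i < n \<Longrightarrow> s i < s (Suc i)) \<Longrightarrow>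
         indep_vars (\<lambda>_. borel) (\<lambda>i \<omega>. Z (s (Suc i)) \<omega> - Z (s i) \<omega>) {..<(n::nat)}"
    and stationary_increments:
      "0 \<le> t \<Longrightarrow> 0 \<le> h \<Longrightarrow>
         distr M borel (\<lambda>\<omega>. Z (t + h) \<omega> - Z t \<omega>) = distr M borel (Z h)"
    and stochastically_continuous:
      "0 \<le> t \<Longrightarrow> 0 < \<epsilon> \<Longrightarrow>
         ((\<lambda>r. prob {\<omega> \<in> space M. \<bar>Z r \<omega> - Z t \<omega>\<bar> > \<epsilon>}) \<longlongrightarrow> 0) (at t within {0..})"
    and cadlag_paths: "AE \<omega> in M. cadlag (\<lambda>t. Z t \<omega>)"

definition characteristic_exponent ::
    "'a measure \<Rightarrow> (real \<Rightarrow> 'a \<Rightarrow> real) \<Rightarrow> (real \<Rightarrow> complex) \<Rightarrow> bool" where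
  "characteristic_exponent M Z \<psi> \<longleftrightarrow>
     (\<forall>t\<ge>0. \<forall>\<xi>. char (distr M borel (Z t)) \<xi> = exp (- complex_of_real t * \<psi> \<xi>))"

definition levy_measure :: "real measure \<Rightarrow> bool" where
  "levy_measure \<mu> \<longleftrightarrow>
     sets \<mu> = sets borel \<and> emeasure \<mu> {0} = 0 \<and> (\<integral>\<^sup>+u. ennreal (min 1 (u\<^sup>2)) \<partial>\<mu>) < \<infinity>"

text \<open>The Levy-Khinchin formula without a quadratic (Gaussian) term. In the convention
  \<open>E exp (i \<xi> Z\<^sub>t) = exp (- t \<psi> \<xi>)\<close> the drift of the process is \<open>- a\<close>.\<close>

definition levy_khinchin :: "real \<Rightarrow> real measure \<Rightarrow> real \<Rightarrow> complex" where
  "levy_khinchin a \<mu> \<xi> =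
     \<i> * complex_of_real (a * \<xi>) +
     (CLINT u|\<mu>. 1 - iexp (\<xi> * u) + \<i> * complex_of_real (\<xi> * u * indicator {u. \<bar>u\<bar> < 1} u))"

definition psi_L :: "real measure \<Rightarrow> real \<Rightarrow> real" where
  "psi_L \<mu> \<xi> = (LINT u:{u. \<bar>\<xi> * u\<bar> < 1}|\<mu>. (\<xi> * u)\<^sup>2)"

definition psi_U :: "real measure \<Rightarrow> real \<Rightarrow> real" where
  "psi_U \<mu> \<xi> = (LINT u|\<mu>. min ((\<xi> * u)\<^sup>2) 1)"

definition condition_A :: "real measure \<Rightarrow> bool" where
  "condition_A \<mu> \<longleftrightarrow> (\<exists>\<beta>>1. \<forall>\<xi>. psi_U \<mu> \<xi> \<le> \<beta> * psi_L \<mu> \<xi>)"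

definition rho :: "(real \<Rightarrow> complex) \<Rightarrow> real \<Rightarrow> real" where
  "rho \<psi> t = Inf {\<xi>. \<xi> > 0 \<and> Re (\<psi> \<xi>) \<ge> 1 / t}"

definition infinitely_differentiable :: "(real \<Rightarrow> real) \<Rightarrow> bool" where
  "infinitely_differentiable f \<longleftrightarrow> (\<forall>n x. ((deriv ^^ n) f) field_differentiable (at x))"

definition is_maximum :: "(real \<Rightarrow> real) \<Rightarrow> real \<Rightarrow> bool" where
  "is_maximum f m \<longleftrightarrow> (\<exists>x. f x = m) \<and> (\<forall>x. f x \<le> m)"

end

theory Submission
  imports Defs
begin

text \<open>
  The idea is that both bounds are integrals of the characteristic function
  \<open>\<phi>\<^sub>t = exp (- t \<psi>)\<close>, whose modulus is \<open>exp (- t Re \<psi>)\<close>, and that condition A makes this modulus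
  essentially a bump of height one and width \<open>\<rho>\<^sub>t\<close>.

  Since \<open>1 - cos x\<close> is comparable to \<open>min (x\<^sup>2) 1\<close> from above, and to \<open>x\<^sup>2\<close> on \<open>\<bar>x\<bar> < 1\<close> from below,
  condition A makes \<open>Re \<psi>\<close> comparable to \<open>\<psi>\<^sup>U\<close>. The function \<open>\<psi>\<^sup>U\<close> grows in a controlled way:
  \<open>\<psi>\<^sup>U (2 \<xi>) - \<psi>\<^sup>U \<xi>\<close> is at least \<open>3/4 \<psi>\<^sup>L (2 \<xi>)\<close>, hence by condition A at least a fixed fraction of
  \<open>\<psi>\<^sup>U (2 \<xi>)\<close>, so \<open>\<psi>\<^sup>U (2 \<xi>) \<ge> q \<psi>\<^sup>U \<xi>\<close> with a constant \<open>q > 1\<close> (\<open>psi_U_doubling\<close>). This is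
  the discrete form of \<open>\<xi> (\<psi>\<^sup>U)' = 2 \<psi>\<^sup>L \<ge> (2 / \<beta>) \<psi>\<^sup>U\<close>. Growth by a factor \<open>q\<close> per doubling is power growth, so
  whenever \<open>t Re \<psi> r \<ge> 1\<close>, the function \<open>\<bar>\<phi>\<^sub>t\<bar>\<close> decays faster than any power of \<open>\<xi> / r\<close>, with
  constants that do not see \<open>t\<close> and \<open>r\<close> (\<open>moment_exp_Re_levy_khinchin_le\<close>).

  All moments of \<open>\<bar>\<phi>\<^sub>t\<bar>\<close> are therefore finite, and Fourier inversion provides a smooth density \<open>p\<^sub>t\<close>.
  The upper bound is \<open>p\<^sub>t \<le> (1/2\<pi>) \<integral> \<bar>\<phi>\<^sub>t\<bar> \<le> d r\<close> for every \<open>r\<close> with \<open>Re \<psi> r \<ge> 1/t\<close>, followed by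
  the infimum over these \<open>r\<close>. For the lower bound, the maximum of \<open>p\<^sub>t\<close> dominates the mean of
  \<open>p\<^sub>t (Z\<^sub>t)\<close>, and by Fubini this mean is \<open>(1/2\<pi>) \<integral> \<bar>\<phi>\<^sub>t\<bar>\<^sup>2\<close> (\<open>expectation_inverse_fourier_char\<close>, a form
  of Plancherel's identity); on \<open>(0, \<rho>\<^sub>t)\<close> the integrand is at least \<open>exp (- 2)\<close>
  because \<open>t Re \<psi> < 1\<close> there.
\<close>

section \<open>Elementary estimates\<close>

lemma quarter_square_le_one_minus_cos:
  fixes x :: real
  assumes "\<bar>x\<bar> \<le> 1"
  shows "x\<^sup>2 / 4 \<le> 1 - cos x"
proof -
  have 1: "\<bar>Re (iexp x - (\<Sum>k\<le>3. (\<i> * x)^k / fact k))\<bar> \<le> \<bar>x\<bar>^4 / 24"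
    using order_trans[OF abs_Re_le_cmod iexp_approx1[of x 3]] by (simp add: fact_numeral)
  have 2: "Re (iexp x - (\<Sum>k\<le>3. (\<i> * x)^k / fact k)) = cos x - (1 - x\<^sup>2 / 2)"
    by (simp add: eval_nat_numeral Re_exp power2_eq_square)
  have "\<bar>x\<bar> ^ 4 \<le> \<bar>x\<bar>\<^sup>2"
    using power_decreasing[of 2 4 "\<bar>x\<bar>"] assms by simp
  with 1 2 show ?thesis
    using zero_le_power2[of x] unfolding power2_abs by linarith
qed

lemma one_minus_cos_le:
  fixes x :: real
  shows "1 - cos x \<le> 2 * min (x\<^sup>2) 1"
proof -
  have "\<bar>Re (iexp x - (\<Sum>k\<le>1. (\<i> * x)^k / fact k))\<bar> \<le> x\<^sup>2 / 2"
    using order_trans[OF abs_Re_le_cmod iexp_approx1[of x 1]] by (simp add: numeral_2_eq_2)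
  then have "1 - cos x \<le> x\<^sup>2 / 2"
    by (simp add: Re_exp)
  then have "1 - cos x \<le> 2 * x\<^sup>2" "1 - cos x \<le> 2 * 1"
    using cos_ge_minus_one[of x] zero_le_power2[of x] by linarith+
  then show ?thesis
    by (simp add: min_def)
qed

lemma power_mult_exp_minus_le_fact:
  fixes y :: real
  assumes "y \<ge> 0"
  shows "y ^ n * exp (- y) \<le> fact n"
proof -
  have "(\<Sum>k\<in>{n}. y ^ k /\<^sub>R fact k) \<le> exp y"
    unfolding exp_def using assms
    by (intro sum_le_suminf summable_exp_generic) auto
  then show ?thesis
    by (simp add: exp_minus field_simps)
qed

text \<open>
  A factor \<open>q\<close> per doubling gives growth of order \<open>\<alpha> = log\<^sub>2 q\<close>. With \<open>N \<ge> k / \<alpha>\<close>, which is the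
  hypothesis \<open>2 ^ k \<le> q ^ N\<close>, the power \<open>N\<close> of \<open>f x / f r\<close> dominates \<open>(x / r) ^ k\<close>. The extra factor \<open>q\<close>
  pays for the incomplete last doubling.
\<close>

lemma power_growth_of_doubling:
  fixes f :: "real \<Rightarrow> real"
  assumes mono: "\<And>x y. 0 < x \<Longrightarrow> x \<le> y \<Longrightarrow> f x \<le> f y"
    and doubling: "\<And>x. 0 < x \<Longrightarrow> q * f x \<le> f (2 * x)"
    and q: "q \<ge> 1" "2 ^ k \<le> q ^ N"
    and r: "0 < r" "0 < f r"
    and "r \<le> x"
  shows "(x / r) ^ k \<le> (q * (f x / f r)) ^ N"
proof -
  \<comment> \<open>Induction on the number of doublings that lead from \<open>r\<close> beyond \<open>x\<close>.\<close>
  have "(x / r) ^ k \<le> (q * (f x / f r)) ^ N" if "r \<le> x" "x < 2 ^ m * r" for m x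
    using that
  proof (induction m arbitrary: x)
    case (Suc m)
    show ?case
    proof (cases "x < 2 * r")
      case True
      have "(x / r) ^ k \<le> 2 ^ k"
        using Suc.prems r True by (intro power_mono) (auto simp: field_simps)
      also have "\<dots> \<le> (q * 1) ^ N" using q by simp
      also have "\<dots> \<le> (q * (f x / f r)) ^ N"
        using q mono[OF r(1) Suc.prems(1)] r by (intro power_mono mult_left_mono) auto
      finally show ?thesis .
    next
      case False
      then have x: "r \<le> x / 2" "0 < x / 2" "x / 2 < 2 ^ m * r"
        using Suc.prems r by auto
      have nn: "0 \<le> f (x / 2) / f r"
        using mono[OF r(1) x(1)] r by (intro divide_nonneg_pos) auto
      then have nn': "0 \<le> q * f (x / 2) / f r"
        using mult_nonneg_nonneg[of q, OF _ nn] q by simp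
      have "(x / r) ^ k = 2 ^ k * (x / 2 / r) ^ k"
        by (simp flip: power_mult_distrib)
      also have "\<dots> \<le> q ^ N * (q * (f (x / 2) / f r)) ^ N"
        using Suc.IH[OF x(1,3)] q x r by (intro mult_mono) auto
      also have "\<dots> = (q * ((q * f (x / 2)) / f r)) ^ N"
        by (simp flip: power_mult_distrib)
      also have "\<dots> \<le> (q * (f x / f r)) ^ N"
        using doubling[OF x(2)] q r nn'
        by (intro power_mono mult_left_mono divide_right_mono mult_nonneg_nonneg) auto
      finally show ?thesis .
    qed
  qed simp
  moreover obtain m where "x / r < 2 ^ m"
    using real_arch_pow[of 2 "x / r"] by auto
  ultimately show ?thesis
    using assms by (simp add: field_simps)
qed

text \<open>
  The decay of the characteristic function is measured against this profile of width \<open>r\<close>: its integral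
  is a multiple of \<open>r\<close>, which is how the scale enters the upper bound.
\<close>

lemma
  assumes "r > 0"
  shows integrable_inverse_1_plus_square_scaled: "integrable lborel (\<lambda>x. 1 / (1 + (x / r)\<^sup>2))"
    and integral_inverse_1_plus_square_scaled: "(LBINT x. 1 / (1 + (x / r)\<^sup>2)) = pi * r"
proof -
  have int: "integrable lborel (\<lambda>x::real. 1 / (1 + x\<^sup>2))"
    using integrable_inverse_1_plus_square by (simp add: set_integrable_def inverse_eq_divide)
  then show "integrable lborel (\<lambda>x. 1 / (1 + (x / r)\<^sup>2))"
    using lborel_integrable_real_affine[OF int, of "1 / r" 0] assms by simp
  have "(LBINT x. 1 / (1 + x\<^sup>2)) = pi"
    using LBINT_inverse_1_plus_square
    by (simp add: interval_lebesgue_integral_def set_lebesgue_integral_def inverse_eq_divide)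
  then show "(LBINT x. 1 / (1 + (x / r)\<^sup>2)) = pi * r"
    using lborel_integral_real_affine[of "1 / r" "\<lambda>x. 1 / (1 + x\<^sup>2)" 0] assms by (simp add: field_simps)
qed

section \<open>Inverse Fourier integrals and their derivatives\<close>

text \<open>
  Integrals against \<open>iexp\<close> come with explicit quadratic error bounds, so derivatives are read off from
  an inequality, without a limit passage under the integral.
\<close>

lemma has_real_derivative_if_quadratic_error:
  fixes f :: "real \<Rightarrow> real"
  assumes "\<And>h. \<bar>f (x + h) - f x - h * D\<bar> \<le> C * h\<^sup>2"
  shows "(f has_real_derivative D) (at x)"
proof -
  have "(\<lambda>h. (f (x + h) - f x) / h - D) \<midarrow>0\<rightarrow> 0"
  proof (rule Lim_null_comparison)
    show "\<forall>\<^sub>F h in at 0. norm ((f (x + h) - f x) / h - D) \<le> \<bar>C * h\<bar>"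
    proof (rule eventually_at_topological[THEN iffD2], intro exI[of _ UNIV] conjI ballI impI)
      fix h :: real assume "h \<noteq> 0"
      then have "norm ((f (x + h) - f x) / h - D) = \<bar>f (x + h) - f x - h * D\<bar> / \<bar>h\<bar>"
        by (simp add: field_simps flip: abs_divide)
      also have "\<dots> \<le> (C * h\<^sup>2) / \<bar>h\<bar>"
        by (intro divide_right_mono assms) auto
      also have "\<dots> \<le> \<bar>C * h\<bar>"
        using abs_ge_self[of "C * h\<^sup>2"] \<open>h \<noteq> 0\<close>
        by (simp add: divide_le_eq abs_mult power2_eq_square mult.assoc)
      finally show "norm ((f (x + h) - f x) / h - D) \<le> \<bar>C * h\<bar>" .
    qed auto
    show "((\<lambda>h. \<bar>C * h\<bar>) \<longlongrightarrow> 0) (at 0)"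
      by (auto intro!: tendsto_eq_intros)
  qed
  then show ?thesis
    by (simp add: DERIV_def LIM_zero_iff)
qed

text \<open>
  Domination alone suffices because the Bochner integral of a non-integrable function is \<open>0\<close>.
\<close>

lemma norm_integral_le_AE:
  fixes f :: "'b \<Rightarrow> 'c :: {banach, second_countable_topology}"
  assumes "integrable N g" "AE x in N. norm (f x) \<le> g x"
  shows "norm (\<integral>x. f x \<partial>N) \<le> (\<integral>x. g x \<partial>N)"
proof -
  have "norm (\<integral>x. f x \<partial>N) \<le> (\<integral>x. norm (f x) \<partial>N)"
    by (rule integral_norm_bound)
  also have "\<dots> \<le> (\<integral>x. g x \<partial>N)"
    using assms by (intro integral_mono_AE') (auto elim!: eventually_mono intro: order_trans[OF norm_ge_zero])
  finally show ?thesis .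
qed

lemma cmod_iexp_minus_linear_le: "cmod (iexp x - 1 - \<i> * x) \<le> x\<^sup>2 / 2"
  using iexp_approx1[of x 1] by (simp add: numeral_2_eq_2 algebra_simps)

lemma cmod_iexp_minus_1_le: "cmod (iexp x - 1) \<le> \<bar>x\<bar>"
  using iexp_approx1[of x 0] by simp

lemma integrable_iexp_mult:
  fixes g :: "real \<Rightarrow> complex"
  assumes "integrable lborel g"
  shows "integrable lborel (\<lambda>\<xi>. iexp (- (\<xi> * x)) * g \<xi>)"
  using assms by (rule Bochner_Integration.integrable_bound)
    (use assms in \<open>auto simp: norm_mult borel_measurable_integrable\<close>)

text \<open>
  The real part is taken because the transforms of interest, densities and their derivatives, are
  real-valued, which spares a separate proof of this.
\<close>

definition inverse_fourier :: "(real \<Rightarrow> complex) \<Rightarrow> real \<Rightarrow> real" where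
  "inverse_fourier g x = 1 / (2 * pi) * Re (CLBINT \<xi>. iexp (- (\<xi> * x)) * g \<xi>)"

text \<open>
  Differentiation under the integral sign: \<open>\<bar>iexp y - 1 - \<i> y\<bar> \<le> y\<^sup>2 / 2\<close> with \<open>y = - \<xi> h\<close> bounds the error of
  the linear approximation by \<open>h\<^sup>2\<close> times the second absolute moment of \<open>g\<close>.
\<close>

lemma has_real_derivative_inverse_fourier:
  fixes g :: "real \<Rightarrow> complex"
  assumes g: "integrable lborel g"
    and g1: "integrable lborel (\<lambda>\<xi>. \<xi> * g \<xi>)"
    and g2: "integrable lborel (\<lambda>\<xi>. \<xi>\<^sup>2 * norm (g \<xi>))"
  shows "(inverse_fourier g has_real_derivative
      inverse_fourier (\<lambda>\<xi>. - \<i> * (\<xi> * g \<xi>)) x) (at x)"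
proof (rule has_real_derivative_if_quadratic_error)
  fix h :: real
  let ?I = "\<lambda>x g. CLBINT \<xi>. iexp (- (\<xi> * x)) * g \<xi>"
  let ?g' = "\<lambda>\<xi>. - \<i> * (\<xi> * g \<xi>)"
  have g1': "integrable lborel ?g'"
    using g1 by simp
  have "?I (x + h) g - ?I x g - h * ?I x ?g' =
      (CLBINT \<xi>. iexp (- (\<xi> * x)) * g \<xi> * (iexp (- (\<xi> * h)) - 1 - \<i> * (- (\<xi> * h))))"
  proof -
    have "?I (x + h) g - ?I x g - h * ?I x ?g' =
        (CLBINT \<xi>. iexp (- (\<xi> * (x + h))) * g \<xi> - iexp (- (\<xi> * x)) * g \<xi>
          - h * (iexp (- (\<xi> * x)) * ?g' \<xi>))"
      using integrable_iexp_mult[OF g, of "x + h"] integrable_iexp_mult[OF g, of x]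
        integrable_iexp_mult[OF g1', of x]
      by (simp del: of_real_mult of_real_minus of_real_add mult_minus_left mult_minus_right)
    moreover have "iexp (- (\<xi> * (x + h))) = iexp (- (\<xi> * x)) * iexp (- (\<xi> * h))" for \<xi>
      by (simp add: algebra_simps flip: exp_add)
    moreover have "A * B * c - A * c - h * (A * (- \<i> * (\<xi> * c))) = A * c * (B - 1 - \<i> * (- (\<xi> * h)))"
      for A B c :: complex and \<xi> :: real
      by (simp add: algebra_simps)
    ultimately show ?thesis
      by (simp only:)
  qed
  also have "cmod \<dots> \<le> (LBINT \<xi>. \<xi>\<^sup>2 * norm (g \<xi>) * (h\<^sup>2 / 2))"
  proof (rule norm_integral_le_AE)
    show "integrable lborel (\<lambda>\<xi>. \<xi>\<^sup>2 * norm (g \<xi>) * (h\<^sup>2 / 2))"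
      using g2 by simp
    have "cmod (iexp (- (\<xi> * x)) * g \<xi> * (iexp (- (\<xi> * h)) - 1 - \<i> * (- (\<xi> * h))))
        \<le> \<xi>\<^sup>2 * norm (g \<xi>) * (h\<^sup>2 / 2)" for \<xi>
      using mult_left_mono[OF cmod_iexp_minus_linear_le[of "- (\<xi> * h)"], of "norm (g \<xi>)"]
      unfolding norm_mult norm_exp_i_times power_mult_distrib power2_minus mult_1_left
      by (simp only: norm_ge_zero times_divide_eq_right mult_ac simp_thms)
    then show "AE \<xi> in lborel. cmod (iexp (- (\<xi> * x)) * g \<xi> * (iexp (- (\<xi> * h)) - 1 - \<i> * (- (\<xi> * h))))
        \<le> \<xi>\<^sup>2 * norm (g \<xi>) * (h\<^sup>2 / 2)"
      by (intro AE_I2)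
  qed
  also have "\<dots> = (LBINT \<xi>. \<xi>\<^sup>2 * norm (g \<xi>)) / 2 * h\<^sup>2"
    by simp
  finally have "\<bar>Re (?I (x + h) g - ?I x g - h * ?I x ?g')\<bar> \<le> (LBINT \<xi>. \<xi>\<^sup>2 * norm (g \<xi>)) / 2 * h\<^sup>2"
    using abs_Re_le_cmod order_trans by blast
  then have "1 / (2 * pi) * \<bar>Re (?I (x + h) g - ?I x g - h * ?I x ?g')\<bar>
      \<le> 1 / (2 * pi) * ((LBINT \<xi>. \<xi>\<^sup>2 * norm (g \<xi>)) / 2 * h\<^sup>2)"
    by (rule mult_left_mono) simp
  also have "1 / (2 * pi) * \<bar>Re (?I (x + h) g - ?I x g - h * ?I x ?g')\<bar> =
    \<bar>1 / (2 * pi) * Re (?I (x + h) g - ?I x g - h * ?I x ?g')\<bar>"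
    by (simp add: abs_mult)
  also have "1 / (2 * pi) * Re (?I (x + h) g - ?I x g - h * ?I x ?g') =
    inverse_fourier g (x + h) - inverse_fourier g x - h * inverse_fourier ?g' x"
    unfolding inverse_fourier_def by (simp add: diff_divide_distrib add_divide_distrib)
  finally show "\<bar>inverse_fourier g (x + h) - inverse_fourier g x - h * inverse_fourier ?g' x\<bar>
      \<le> (1 / (2 * pi) * ((LBINT \<xi>. \<xi>\<^sup>2 * norm (g \<xi>)) / 2)) * h\<^sup>2"
    by (simp only: mult.assoc)
qed

lemma infinitely_differentiable_inverse_fourier:
  fixes g :: "real \<Rightarrow> complex"
  assumes [measurable]: "g \<in> borel_measurable borel"
    and mom: "\<And>n. integrable lborel (\<lambda>\<xi>. \<bar>\<xi>\<bar> ^ n * norm (g \<xi>))"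
  shows "infinitely_differentiable (inverse_fourier g)"
proof -
  let ?g = "\<lambda>n \<xi>. (- \<i> * complex_of_real \<xi>) ^ n * g \<xi>"
  have int: "integrable lborel (\<lambda>\<xi>. complex_of_real \<xi> ^ m * ?g n \<xi>)" for n m
    by (rule Bochner_Integration.integrable_bound[OF mom[of "m + n"]])
       (auto simp: norm_mult norm_power power_add intro!: AE_I2)
  have deriv_g: "(inverse_fourier (?g n) has_real_derivative inverse_fourier (?g (Suc n)) x) (at x)" for n x
  proof -
    have "(inverse_fourier (?g n) has_real_derivative
        inverse_fourier (\<lambda>\<xi>. - \<i> * (\<xi> * ?g n \<xi>)) x) (at x)"
    proof (rule has_real_derivative_inverse_fourier)
      show "integrable lborel (?g n)" using int[of 0 n] by simp
      show "integrable lborel (\<lambda>\<xi>. \<xi> * ?g n \<xi>)" using int[of 1 n] by simp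
      show "integrable lborel (\<lambda>\<xi>. \<xi>\<^sup>2 * norm (?g n \<xi>))"
        using integrable_norm[OF int[of 2 n]] by (simp add: norm_mult norm_power)
    qed
    then show ?thesis by (simp add: algebra_simps)
  qed
  have "(deriv ^^ n) (inverse_fourier g) = inverse_fourier (?g n)" for n
  proof (induction n)
    case (Suc n)
    then show ?case using deriv_g[of n] by (auto intro!: ext DERIV_imp_deriv)
  qed simp
  then show ?thesis
    unfolding infinitely_differentiable_def field_differentiable_def using deriv_g by auto
qed

lemma abs_inverse_fourier_le:
  assumes "integrable lborel g"
  shows "\<bar>inverse_fourier g x\<bar> \<le> 1 / (2 * pi) * (LBINT \<xi>. norm (g \<xi>))"
proof -
  have "\<bar>Re (CLBINT \<xi>. iexp (- (\<xi> * x)) * g \<xi>)\<bar> \<le> cmod (CLBINT \<xi>. iexp (- (\<xi> * x)) * g \<xi>)"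
    by (rule abs_Re_le_cmod)
  also have "\<dots> \<le> (LBINT \<xi>. norm (iexp (- (\<xi> * x)) * g \<xi>))"
    by (rule integral_norm_bound)
  also have "\<dots> = (LBINT \<xi>. norm (g \<xi>))"
    by (simp add: norm_mult)
  finally show ?thesis
    unfolding inverse_fourier_def by (simp add: abs_mult divide_right_mono)
qed

section \<open>Inversion for an integrable characteristic function\<close>

text \<open>
  The kernel of Levy's inversion formula, equal to the integral of \<open>iexp (- (t * x))\<close> over \<open>x\<close> from \<open>a\<close> to
  \<open>b\<close> for \<open>t \<noteq> 0\<close>; hence it is at most \<open>\<bar>b - a\<bar>\<close> and close to \<open>(b - a) iexp (- (t * a))\<close>. At
  \<open>t = 0\<close> division by zero gives \<open>0\<close> instead of \<open>b - a\<close>, which changes only a null set.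
\<close>

definition levy_kernel :: "real \<Rightarrow> real \<Rightarrow> real \<Rightarrow> complex" where
  "levy_kernel a b t = (iexp (- (t * a)) - iexp (- (t * b))) / (\<i> * t)"

lemma borel_measurable_levy_kernel [measurable]: "levy_kernel a b \<in> borel_measurable borel"
  unfolding levy_kernel_def[abs_def] by measurable

lemma levy_kernel_swap: "levy_kernel b a t = - levy_kernel a b t"
  by (simp only: levy_kernel_def minus_divide_left minus_diff_eq)

lemma levy_kernel_factor:
  "levy_kernel a b t = iexp (- (t * a)) * (1 - iexp (- (t * (b - a)))) / (\<i> * t)"
proof -
  have "iexp (- (t * b)) = iexp (- (t * a)) * iexp (- (t * (b - a)))"
    by (simp add: algebra_simps flip: exp_add)
  then show ?thesis
    unfolding levy_kernel_def by (simp only: right_diff_distrib mult_1_right)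
qed

lemma cmod_levy_kernel_le: "cmod (levy_kernel a b t) \<le> \<bar>b - a\<bar>"
proof (cases "t = 0")
  case False
  have "cmod (levy_kernel a b t) = cmod (iexp (- (t * (b - a))) - 1) / \<bar>t\<bar>"
    unfolding levy_kernel_factor norm_divide norm_mult by (simp add: norm_minus_commute)
  also have "\<dots> \<le> \<bar>- (t * (b - a))\<bar> / \<bar>t\<bar>"
    by (intro divide_right_mono cmod_iexp_minus_1_le) simp
  finally show ?thesis using False by (simp add: abs_mult)
qed (simp add: levy_kernel_def)

lemma cmod_levy_kernel_minus_linear_le:
  assumes "t \<noteq> 0"
  shows "cmod (levy_kernel a b t - complex_of_real (b - a) * iexp (- (t * a))) \<le> (b - a)\<^sup>2 / 2 * \<bar>t\<bar>"
proof -
  let ?y = "- (t * (b - a))"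
  have *: "A * (1 - B) / (\<i> * t) - (b - a) * A = - A * (B - 1 - \<i> * complex_of_real ?y) / (\<i> * t)" for A B :: complex
    using assms by (simp add: field_simps)
  have "cmod (levy_kernel a b t - complex_of_real (b - a) * iexp (- (t * a))) = cmod (iexp ?y - 1 - \<i> * ?y) / \<bar>t\<bar>"
    unfolding levy_kernel_factor * norm_divide norm_mult norm_minus_cancel by simp
  also have "\<dots> \<le> (?y\<^sup>2 / 2) / \<bar>t\<bar>"
    by (intro divide_right_mono cmod_iexp_minus_linear_le) simp
  also have "\<dots> = (b - a)\<^sup>2 / 2 * \<bar>t\<bar>"
    using assms
    by (simp add: power_mult_distrib divide_eq_eq power2_eq_square[of t])
  finally show ?thesis .
qed

context real_distribution
begin

lemma integrable_levy_kernel_char: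
  assumes "integrable lborel (char M)"
  shows "integrable lborel (\<lambda>t. levy_kernel a b t * char M t)"
proof (rule Bochner_Integration.integrable_bound)
  show "integrable lborel (\<lambda>t. \<bar>b - a\<bar> * cmod (char M t))"
    using assms by auto
  show "AE t in lborel. norm (levy_kernel a b t * char M t) \<le> norm (\<bar>b - a\<bar> * cmod (char M t))"
    by (intro AE_I2) (simp add: norm_mult mult_right_mono cmod_levy_kernel_le)
qed measurable

text \<open>
  If the characteristic function is integrable, the principal value in the inversion formula is an
  ordinary integral, by dominated convergence.
\<close>

lemma measure_Ioc_eq_integral_char:
  assumes "a \<le> b" "measure M {a} = 0" "measure M {b} = 0"
    and char: "integrable lborel (char M)"
  shows "measure M {a<..b} = 1 / (2 * pi) * (CLBINT t. levy_kernel a b t * char M t)"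
proof (rule LIMSEQ_unique)
  show "(\<lambda>T::nat. 1 / (2 * pi) * (CLBINT t=-T..T. levy_kernel a b t * char M t))
      \<longlonglongrightarrow> of_real (measure M {a<..b})"
    using Levy_Inversion[OF assms(1-3)] unfolding levy_kernel_def by simp
  have "(\<lambda>T::nat. CLBINT t. indicator {- real T<..<real T} t *\<^sub>R (levy_kernel a b t * char M t))
      \<longlonglongrightarrow> (CLBINT t. levy_kernel a b t * char M t)"
  proof (rule integral_dominated_convergence[where w="\<lambda>t. norm (levy_kernel a b t * char M t)"])
    show "integrable lborel (\<lambda>t. norm (levy_kernel a b t * char M t))"
      by (intro integrable_norm integrable_levy_kernel_char char)
    show "AE t in lborel. (\<lambda>T::nat. indicator {- real T<..<real T} t *\<^sub>R (levy_kernel a b t * char M t))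
        \<longlonglongrightarrow> levy_kernel a b t * char M t"
    proof (intro AE_I2 tendsto_eventually)
      fix t :: real
      obtain N :: nat where "\<bar>t\<bar> < real N" using reals_Archimedean2 by blast
      then have "\<bar>t\<bar> < real T" if "N \<le> T" for T :: nat
        using that by linarith
      then show "\<forall>\<^sub>F T::nat in sequentially. indicator {- real T<..<real T} t *\<^sub>R (levy_kernel a b t * char M t)
          = levy_kernel a b t * char M t"
        unfolding eventually_sequentially
        by (intro exI[of _ N] allI impI) (simp add: abs_less_iff minus_less_iff)
    qed
  qed (auto split: split_indicator)
  then show "(\<lambda>T::nat. 1 / (2 * pi) * (CLBINT t=-T..T. levy_kernel a b t * char M t))
      \<longlonglongrightarrow> 1 / (2 * pi) * (CLBINT t. levy_kernel a b t * char M t)"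
    by (intro tendsto_mult tendsto_const)
       (simp add: interval_lebesgue_integral_def set_lebesgue_integral_def)
qed

text \<open>
  The inversion formula gives mass at most a constant times \<open>b - a\<close> to an interval whose end points are
  not atoms. There are only countably many atoms, so every point lies in arbitrarily short
  intervals of this kind.
\<close>

lemma no_atoms_if_integrable_char:
  assumes char: "integrable lborel (char M)"
  shows "measure M {x} = 0"
proof -
  let ?C = "LBINT t. cmod (char M t)"
  have bound: "measure M {x} \<le> 1 / (2 * pi) * ?C * e" if "e > 0" for e
  proof -
    obtain a where a: "x - e / 2 < a" "a < x" "measure M {a} = 0"
      using open_minus_countable[OF countable_support, of "{x - e / 2<..<x}"] \<open>e > 0\<close> by auto
    obtain b where b: "x < b" "b < x + e / 2" "measure M {b} = 0"
      using open_minus_countable[OF countable_support, of "{x<..<x + e / 2}"] \<open>e > 0\<close> by auto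
    have "measure M {x} \<le> measure M {a<..b}"
      using a b by (intro finite_measure_mono) auto
    also have "\<dots> = cmod (complex_of_real (measure M {a<..b}))"
      by simp
    also have "\<dots> = 1 / (2 * pi) * cmod (CLBINT t. levy_kernel a b t * char M t)"
      using a b by (subst measure_Ioc_eq_integral_char[OF _ _ _ char]) (auto simp: norm_mult norm_divide)
    also have "cmod (CLBINT t. levy_kernel a b t * char M t) \<le> (LBINT t. e * cmod (char M t))"
    proof (intro norm_integral_le_AE AE_I2)
      fix t
      have "cmod (levy_kernel a b t) \<le> e"
        using cmod_levy_kernel_le[of a b t] a b by auto
      then show "cmod (levy_kernel a b t * char M t) \<le> e * cmod (char M t)"
        by (simp add: norm_mult mult_right_mono)
    qed (use char in auto)
    finally show ?thesis
      by (simp add: divide_right_mono mult_ac)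
  qed
  define c where "c = 1 / (2 * pi) * ?C"
  have c: "c \<ge> 0" by (simp add: c_def)
  show ?thesis
  proof (rule ccontr)
    assume "measure M {x} \<noteq> 0"
    then have pos: "measure M {x} > 0" by (simp add: zero_less_measure_iff)
    with c have "measure M {x} \<le> c * (measure M {x} / (c + 1))"
      unfolding c_def by (intro bound divide_pos_pos) linarith+
    with c have "measure M {x} * (c + 1) \<le> c * measure M {x}"
      by (simp add: pos_le_divide_eq add_nonneg_pos)
    with pos show False
      by (simp add: algebra_simps)
  qed
qed

text \<open>
  Without atoms the inversion formula holds for all end points, and since the kernel is antisymmetric,
  in either order. This allows increments of both signs in what follows.
\<close>

lemma cdf_diff_eq_integral_char:
  assumes char: "integrable lborel (char M)"
  shows "cdf M b - cdf M a = 1 / (2 * pi) * Re (CLBINT t. levy_kernel a b t * char M t)"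
proof -
  have *: "cdf M b - cdf M a = 1 / (2 * pi) * Re (CLBINT t. levy_kernel a b t * char M t)" if "a < b" for a b
  proof -
    have "complex_of_real (cdf M b - cdf M a) = complex_of_real (1 / (2 * pi)) * (CLBINT t. levy_kernel a b t * char M t)"
      using cdf_diff_eq[OF that] measure_Ioc_eq_integral_char[OF less_imp_le[OF that] _ _ char]
        no_atoms_if_integrable_char[OF char] by simp
    then have "Re (complex_of_real (cdf M b - cdf M a)) =
        Re (complex_of_real (1 / (2 * pi)) * (CLBINT t. levy_kernel a b t * char M t))"
      by (rule arg_cong)
    then show ?thesis
      by (simp only: Re_complex_of_real Im_complex_of_real times_complex.sel)
  qed
  consider "a < b" | "a = b" | "b < a" by linarith
  then show ?thesis
  proof cases
    case 3
    then show ?thesis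
      using *[OF 3] by (subst levy_kernel_swap) simp
  qed (use * in \<open>auto simp: levy_kernel_def\<close>)
qed

text \<open>
  This estimate carries the rest of the inversion: it differentiates the distribution function, and it
  bounds the density at a point by the mass of a short interval.
\<close>

lemma cdf_quadratic_error:
  assumes char: "integrable lborel (char M)"
    and char1: "integrable lborel (\<lambda>\<xi>. \<bar>\<xi>\<bar> * norm (char M \<xi>))"
  shows "\<bar>cdf M (x + h) - cdf M x - h * inverse_fourier (char M) x\<bar>
    \<le> 1 / (4 * pi) * (LBINT \<xi>. \<bar>\<xi>\<bar> * norm (char M \<xi>)) * h\<^sup>2"
proof -
  let ?K = "\<lambda>t. levy_kernel x (x + h) t - h * iexp (- (t * x))"
  have "cdf M (x + h) - cdf M x - h * inverse_fourier (char M) x =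
      1 / (2 * pi) * Re ((CLBINT t. levy_kernel x (x + h) t * char M t)
        - h * (CLBINT t. iexp (- (t * x)) * char M t))"
    unfolding cdf_diff_eq_integral_char[OF char] inverse_fourier_def by (simp add: diff_divide_distrib)
  also have "(CLBINT t. levy_kernel x (x + h) t * char M t) - h * (CLBINT t. iexp (- (t * x)) * char M t)
      = (CLBINT t. levy_kernel x (x + h) t * char M t - h * (iexp (- (t * x)) * char M t))"
    using integrable_levy_kernel_char[OF char, of x "x + h"] integrable_iexp_mult[OF char, of x]
    by (simp del: of_real_mult of_real_minus)
  also have "\<dots> = (CLBINT t. ?K t * char M t)"
    by (simp only: left_diff_distrib mult.assoc)
  finally have "\<bar>cdf M (x + h) - cdf M x - h * inverse_fourier (char M) x\<bar> \<le>
     1 / (2 * pi) * cmod (CLBINT t. ?K t * char M t)"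
    using abs_Re_le_cmod[of "CLBINT t. ?K t * char M t"] by (simp add: abs_mult divide_right_mono)
  moreover have "cmod (CLBINT t. ?K t * char M t) \<le> (LBINT t. h\<^sup>2 / 2 * (\<bar>t\<bar> * norm (char M t)))"
  proof (rule norm_integral_le_AE)
    show "integrable lborel (\<lambda>t. h\<^sup>2 / 2 * (\<bar>t\<bar> * norm (char M t)))"
      using char1 by simp
    show "AE t in lborel. cmod (?K t * char M t) \<le> h\<^sup>2 / 2 * (\<bar>t\<bar> * cmod (char M t))"
    proof (rule eventually_mono[OF AE_lborel_singleton[of 0]])
      fix t :: real assume "t \<noteq> 0"
      then have "cmod (?K t) \<le> h\<^sup>2 / 2 * \<bar>t\<bar>"
        using cmod_levy_kernel_minus_linear_le[of t x "x + h"] by simp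
      then show "cmod (?K t * char M t) \<le> h\<^sup>2 / 2 * (\<bar>t\<bar> * cmod (char M t))"
        unfolding norm_mult mult.assoc[symmetric] by (rule mult_right_mono) simp
    qed
  qed
  then have "1 / (2 * pi) * cmod (CLBINT t. ?K t * char M t)
      \<le> 1 / (2 * pi) * (h\<^sup>2 / 2 * (LBINT t. \<bar>t\<bar> * norm (char M t)))"
    unfolding integral_mult_right_zero by (rule mult_left_mono) simp
  ultimately show ?thesis
    by (simp add: mult_ac)
qed

end

section \<open>The density and its maximum\<close>

context real_distribution
begin

lemma has_real_derivative_cdf:
  assumes char: "integrable lborel (char M)"
    and char1: "integrable lborel (\<lambda>\<xi>. \<bar>\<xi>\<bar> * norm (char M \<xi>))"
  shows "(cdf M has_real_derivative inverse_fourier (char M) x) (at x)"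
  by (rule has_real_derivative_if_quadratic_error cdf_quadratic_error[OF assms])+

text \<open>
  The inverse transform is the derivative of a nondecreasing function.
\<close>

lemma inverse_fourier_char_nonneg:
  assumes char: "integrable lborel (char M)"
    and char1: "integrable lborel (\<lambda>\<xi>. \<bar>\<xi>\<bar> * norm (char M \<xi>))"
  shows "inverse_fourier (char M) x \<ge> 0"
  by (rule mono_on_imp_deriv_nonneg[OF _ has_real_derivative_cdf[OF assms], of UNIV])
     (auto intro: mono_onI cdf_nondecreasing)

text \<open>
  The fundamental theorem of calculus on a half-line, applied to the distribution function after a
  reflection that turns the lower half-line into an upper one.
\<close>

lemma nn_integral_atMost_inverse_fourier_char:
  assumes char: "integrable lborel (char M)"
    and char1: "integrable lborel (\<lambda>\<xi>. \<bar>\<xi>\<bar> * norm (char M \<xi>))"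
    and [measurable]: "inverse_fourier (char M) \<in> borel_measurable borel"
  shows "(\<integral>\<^sup>+x. ennreal (inverse_fourier (char M) x) * indicator {..a} x \<partial>lborel) = ennreal (cdf M a)"
proof -
  let ?p = "inverse_fourier (char M)"
  have "(\<integral>\<^sup>+x. ennreal (?p x) * indicator {..a} x \<partial>lborel) =
      (\<integral>\<^sup>+x. ennreal (?p (- x)) * indicator {- a..} x \<partial>lborel)"
    using nn_integral_real_affine[of "\<lambda>x. ennreal (?p x) * indicator {..a} x" "-1" 0]
    by (simp add: indicator_def minus_le_iff)
  also have "\<dots> = ennreal (0 - (- cdf M (- (- a))))"
  proof (rule nn_integral_FTC_atLeast)
    show "((\<lambda>x. - cdf M (- x)) has_real_derivative ?p (- x)) (at x)" for x
      using DERIV_minus[OF DERIV_chain2[OF has_real_derivative_cdf[OF char char1] DERIV_minus[OF DERIV_ident]]]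
      by simp
    show "((\<lambda>x. - cdf M (- x)) \<longlongrightarrow> 0) at_top"
      using tendsto_minus[OF filterlim_compose[OF cdf_lim_at_bot filterlim_uminus_at_bot_at_top]] by simp
  qed (use inverse_fourier_char_nonneg[OF char char1] in auto)
  finally show ?thesis by simp
qed

text \<open>
  By the quadratic error bound, the density at \<open>x\<close> exceeds the mean density of \<open>(x, x + h]\<close> by at most
  \<open>C h\<close>. First \<open>h\<close> is chosen to make this excess small, then \<open>\<bar>x\<bar>\<close> large, so that the mass of the interval
  is small compared with \<open>h\<close>.
\<close>

lemma inverse_fourier_char_vanishes_at_infinity:
  assumes char: "integrable lborel (char M)"
    and char1: "integrable lborel (\<lambda>\<xi>. \<bar>\<xi>\<bar> * norm (char M \<xi>))"
    and "\<epsilon> > 0"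
  shows "\<exists>K. \<forall>x. \<bar>x\<bar> > K \<longrightarrow> inverse_fourier (char M) x < \<epsilon>"
proof -
  define C where "C = 1 / (4 * pi) * (LBINT \<xi>. \<bar>\<xi>\<bar> * norm (char M \<xi>))"
  have C: "C \<ge> 0" by (simp add: C_def)
  define h where "h = \<epsilon> / (2 * (C + 1))"
  have h: "h > 0" using C \<open>\<epsilon> > 0\<close> by (simp add: h_def)
  have Ch: "C * h < \<epsilon> / 2"
    using C \<open>\<epsilon> > 0\<close> by (simp add: h_def field_simps)
  have small: "inverse_fourier (char M) x < \<epsilon>" if "cdf M (x + h) - cdf M x < h * \<epsilon> / 2" for x
  proof -
    have "h * inverse_fourier (char M) x \<le> cdf M (x + h) - cdf M x + C * h\<^sup>2"
      using cdf_quadratic_error[OF char char1, of x h] unfolding C_def by linarith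
    also have "\<dots> < h * \<epsilon> / 2 + (C * h) * h"
      using that by (simp add: power2_eq_square)
    also have "\<dots> < h * \<epsilon> / 2 + \<epsilon> / 2 * h"
      by (rule add_strict_left_mono[OF mult_strict_right_mono[OF Ch h]])
    also have "\<dots> = h * \<epsilon>" by simp
    finally show ?thesis using h by simp
  qed
  have "\<forall>\<^sub>F x in at_top. 1 - h * \<epsilon> / 2 < cdf M x"
    using h \<open>\<epsilon> > 0\<close> by (intro order_tendstoD(1)[OF cdf_lim_at_top_prob]) simp
  then obtain K1 where K1: "\<And>x. x \<ge> K1 \<Longrightarrow> 1 - h * \<epsilon> / 2 < cdf M x"
    by (auto simp: eventually_at_top_linorder)
  have "\<forall>\<^sub>F x in at_bot. cdf M x < h * \<epsilon> / 2"
    using h \<open>\<epsilon> > 0\<close> by (intro order_tendstoD(2)[OF cdf_lim_at_bot]) simp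
  then obtain K2 where K2: "\<And>x. x \<le> K2 \<Longrightarrow> cdf M x < h * \<epsilon> / 2"
    by (auto simp: eventually_at_bot_linorder)
  have "inverse_fourier (char M) x < \<epsilon>" if "\<bar>x\<bar> > max \<bar>K1\<bar> (\<bar>K2\<bar> + h)" for x
  proof (rule small, cases "x \<ge> 0")
    case True
    then have "1 - h * \<epsilon> / 2 < cdf M x" using that by (intro K1) auto
    then show "cdf M (x + h) - cdf M x < h * \<epsilon> / 2"
      using cdf_bounded_prob[of "x + h"] by linarith
  next
    case False
    then have "cdf M (x + h) < h * \<epsilon> / 2" using that by (intro K2) auto
    then show "cdf M (x + h) - cdf M x < h * \<epsilon> / 2"
      using cdf_nonneg[of x] by linarith
  qed
  then show ?thesis by blast
qed

text \<open>
  A continuous function that vanishes at infinity and is positive somewhere attains its maximum. It is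
  positive somewhere because otherwise the distribution function would be constant.
\<close>

lemma inverse_fourier_char_has_maximum:
  assumes char: "integrable lborel (char M)"
    and char1: "integrable lborel (\<lambda>\<xi>. \<bar>\<xi>\<bar> * norm (char M \<xi>))"
    and cont: "continuous_on UNIV (inverse_fourier (char M))"
  shows "\<exists>m. is_maximum (inverse_fourier (char M)) m"
proof -
  let ?p = "inverse_fourier (char M)"
  have "\<exists>y. ?p y > 0"
  proof (rule ccontr)
    assume "\<nexists>y. ?p y > 0"
    then have "?p y = 0" for y
      using inverse_fourier_char_nonneg[OF char char1, of y] by (meson leI antisym)
    then have "(cdf M has_real_derivative 0) (at x)" for x
      using has_real_derivative_cdf[OF char char1] by metis
    then have "cdf M x = cdf M 0" for x
      using DERIV_isconst_all by blast
    then have "cdf M = (\<lambda>_. cdf M 0)" by auto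
    then have "(cdf M \<longlongrightarrow> cdf M 0) at_top" "(cdf M \<longlongrightarrow> cdf M 0) at_bot"
      by (metis tendsto_const)+
    then have "cdf M 0 = 1" "cdf M 0 = 0"
      using tendsto_unique[OF trivial_limit_at_top_linorder _ cdf_lim_at_top_prob]
        tendsto_unique[OF trivial_limit_at_bot_linorder _ cdf_lim_at_bot] by metis+
    then show False by simp
  qed
  then obtain y where y: "?p y > 0" by blast
  obtain K where K: "\<And>x. \<bar>x\<bar> > K \<Longrightarrow> ?p x < ?p y"
    using inverse_fourier_char_vanishes_at_infinity[OF char char1 y] by blast
  define R where "R = max K \<bar>y\<bar>"
  have "\<exists>x\<in>{- R..R}. \<forall>z\<in>{- R..R}. ?p z \<le> ?p x"
    by (rule continuous_attains_sup) (auto simp: R_def intro: continuous_on_subset[OF cont])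
  then obtain x where "\<forall>z\<in>{- R..R}. ?p z \<le> ?p x" by blast
  then have x: "?p z \<le> ?p x" if "\<bar>z\<bar> \<le> R" for z
    using that by (auto simp: abs_le_iff)
  have "?p z \<le> ?p x" for z
  proof (cases "\<bar>z\<bar> \<le> R")
    case False
    then have "?p z < ?p y" by (intro K) (auto simp: R_def)
    also have "?p y \<le> ?p x" by (intro x) (simp add: R_def)
    finally show ?thesis by simp
  qed (rule x)
  then show ?thesis unfolding is_maximum_def by blast
qed

lemma char_uminus: "char M (- \<xi>) = cnj (char M \<xi>)"
  unfolding char_def Bochner_Integration.integral_cnj[symmetric]
  by (intro Bochner_Integration.integral_cong refl) (simp add: exp_cnj)

text \<open>
  For a random variable \<open>X\<close> with density \<open>p\<close>, the left-hand side is \<open>E (p X)\<close>, that is, \<open>\<integral> p\<^sup>2\<close>. Writing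
  it as an integral against the distribution makes Plancherel's identity an instance of Fubini's theorem, since
  integrating \<open>iexp (- (\<xi> * x))\<close> gives the conjugate of the characteristic function.
\<close>

lemma expectation_inverse_fourier_char:
  assumes char: "integrable lborel (char M)"
  shows "(\<integral>x. inverse_fourier (char M) x \<partial>M) = 1 / (2 * pi) * (LBINT \<xi>. (cmod (char M \<xi>))\<^sup>2)"
proof -
  interpret P: pair_sigma_finite M lborel ..
  have int: "integrable (M \<Otimes>\<^sub>M lborel) (\<lambda>(x, \<xi>). iexp (- (\<xi> * x)) * char M \<xi>)"
  proof (rule P.Fubini_integrable)
    show "integrable M (\<lambda>x. LBINT y. norm (case (x, y) of (x, \<xi>) \<Rightarrow> iexp (- (\<xi> * x)) * char M \<xi>))"
      by (simp add: norm_mult)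
    show "AE x in M. integrable lborel (\<lambda>y. case (x, y) of (x, \<xi>) \<Rightarrow> iexp (- (\<xi> * x)) * char M \<xi>)"
      using integrable_iexp_mult[OF char] by simp
  qed measurable
  have fst: "integrable M (\<lambda>x. CLBINT \<xi>. iexp (- (\<xi> * x)) * char M \<xi>)"
    using P.integrable_fst[OF int] by simp
  have "(\<integral>x. inverse_fourier (char M) x \<partial>M) =
      1 / (2 * pi) * Re (\<integral>x. (CLBINT \<xi>. iexp (- (\<xi> * x)) * char M \<xi>) \<partial>M)"
    unfolding inverse_fourier_def integral_mult_right_zero using integral_Re[OF fst] by simp
  also have "(\<integral>x. (CLBINT \<xi>. iexp (- (\<xi> * x)) * char M \<xi>) \<partial>M) =
      (CLBINT \<xi>. (\<integral>x. iexp (- (\<xi> * x)) * char M \<xi> \<partial>M))"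
    using P.Fubini_integral[OF int] by simp
  also have "\<dots> = (CLBINT \<xi>. char M (- \<xi>) * char M \<xi>)"
    unfolding char_def by simp
  also have "\<dots> = (CLBINT \<xi>. complex_of_real ((cmod (char M \<xi>))\<^sup>2))"
    by (intro Bochner_Integration.integral_cong refl)
       (simp only: char_uminus complex_norm_square mult.commute)
  also have "\<dots> = complex_of_real (LBINT \<xi>. (cmod (char M \<xi>))\<^sup>2)"
    by (rule integral_complex_of_real)
  finally show ?thesis by simp
qed

end

section \<open>The real part of the Levy exponent\<close>

context
  fixes \<mu> :: "real measure"
  assumes levy: "levy_measure \<mu>"
begin

lemma sets_levy_measure [measurable_cong]: "sets \<mu> = sets borel"
  using levy by (simp add: levy_measure_def)

lemma integrable_min_square: "integrable \<mu> (\<lambda>u. min 1 (u\<^sup>2))"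
  using levy by (intro integrableI_bounded) (auto simp: levy_measure_def)

lemma integrable_psi_U: "integrable \<mu> (\<lambda>u. min ((\<xi> * u)\<^sup>2) 1)"
proof (rule Bochner_Integration.integrable_bound)
  show "integrable \<mu> (\<lambda>u. (1 + \<xi>\<^sup>2) * min 1 (u\<^sup>2))"
    using integrable_min_square by simp
  have "min ((\<xi> * u)\<^sup>2) 1 \<le> (1 + \<xi>\<^sup>2) * min 1 (u\<^sup>2)" for u
    unfolding min_def power_mult_distrib distrib_right
    using zero_le_power2[of \<xi>] zero_le_power2[of u] by (smt (verit) mult_cancel_left1)
  then show "AE u in \<mu>. norm (min ((\<xi> * u)\<^sup>2) 1) \<le> norm ((1 + \<xi>\<^sup>2) * min 1 (u\<^sup>2))"
    by (intro AE_I2) (simp add: abs_of_nonneg)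
qed measurable

lemma integrable_psi_L: "integrable \<mu> (\<lambda>u. indicator {u. \<bar>\<xi> * u\<bar> < 1} u * (\<xi> * u)\<^sup>2)"
  by (rule Bochner_Integration.integrable_bound[OF integrable_psi_U[of \<xi>]])
     (auto intro!: AE_I2 simp: indicator_def abs_square_le_1 power_le_one)

lemma integrable_one_minus_cos: "integrable \<mu> (\<lambda>u. 1 - cos (\<xi> * u))"
proof (rule Bochner_Integration.integrable_bound)
  show "integrable \<mu> (\<lambda>u. 2 * min ((\<xi> * u)\<^sup>2) 1)"
    using integrable_psi_U by simp
  show "AE u in \<mu>. norm (1 - cos (\<xi> * u)) \<le> norm (2 * min ((\<xi> * u)\<^sup>2) 1)"
    using one_minus_cos_le by (intro AE_I2) (simp add: abs_of_nonneg)
qed measurable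

lemma integrable_levy_khinchin:
  "integrable \<mu> (\<lambda>u. 1 - iexp (\<xi> * u) + \<i> * complex_of_real (\<xi> * u * indicator {u. \<bar>u\<bar> < 1} u))"
proof (rule Bochner_Integration.integrable_bound)
  show "integrable \<mu> (\<lambda>u. (2 + \<xi>\<^sup>2) * min 1 (u\<^sup>2))"
    using integrable_min_square by simp
  have "cmod (1 - iexp (\<xi> * u) + \<i> * complex_of_real (\<xi> * u * indicator {u. \<bar>u\<bar> < 1} u))
      \<le> (2 + \<xi>\<^sup>2) * min 1 (u\<^sup>2)" for u
  proof (cases "\<bar>u\<bar> < 1")
    case True
    then have "u\<^sup>2 \<le> 1" by (simp add: abs_square_le_1)
    have "cmod (1 - iexp (\<xi> * u) + \<i> * complex_of_real (\<xi> * u)) =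
        cmod (iexp (\<xi> * u) - (\<Sum>k\<le>1. (\<i> * complex_of_real (\<xi> * u)) ^ k / fact k))"
      by (subst norm_minus_cancel[symmetric]) (simp add: algebra_simps)
    also have "\<dots> \<le> (\<xi> * u)\<^sup>2 / 2"
      using iexp_approx1[of "\<xi> * u" 1] by (simp add: numeral_2_eq_2)
    also have "\<dots> \<le> (2 + \<xi>\<^sup>2) * u\<^sup>2"
      by (simp add: power_mult_distrib distrib_right)
    finally show ?thesis using True \<open>u\<^sup>2 \<le> 1\<close> by (simp add: min_def)
  next
    case False
    then have "u\<^sup>2 \<ge> 1" using abs_le_square_iff[of 1 u] by simp
    have "cmod (1 - iexp (\<xi> * u)) \<le> 2"
      using norm_triangle_ineq4[of 1 "iexp (\<xi> * u)"] by simp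
    also have "2 \<le> 2 + \<xi>\<^sup>2" by simp
    finally show ?thesis using False \<open>u\<^sup>2 \<ge> 1\<close> by (simp add: min_def)
  qed
  then show "AE u in \<mu>. norm (1 - iexp (\<xi> * u) + \<i> * complex_of_real (\<xi> * u * indicator {u. \<bar>u\<bar> < 1} u))
      \<le> norm ((2 + \<xi>\<^sup>2) * min 1 (u\<^sup>2))"
    by (intro AE_I2) (simp add: abs_of_nonneg)
qed measurable

lemma Re_levy_khinchin: "Re (levy_khinchin a \<mu> \<xi>) = (\<integral>u. 1 - cos (\<xi> * u) \<partial>\<mu>)"
  unfolding levy_khinchin_def
  by (simp add: Re_exp integral_Re[OF integrable_levy_khinchin, symmetric] del: of_real_mult)

lemma Re_levy_khinchin_nonneg: "Re (levy_khinchin a \<mu> \<xi>) \<ge> 0"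
  unfolding Re_levy_khinchin by (intro Bochner_Integration.integral_nonneg) auto

lemma Re_levy_khinchin_le_psi_U: "Re (levy_khinchin a \<mu> \<xi>) \<le> 2 * psi_U \<mu> \<xi>"
proof -
  have "(\<integral>u. 1 - cos (\<xi> * u) \<partial>\<mu>) \<le> (\<integral>u. 2 * min ((\<xi> * u)\<^sup>2) 1 \<partial>\<mu>)"
    using integrable_psi_U by (intro integral_mono integrable_one_minus_cos one_minus_cos_le) simp
  then show ?thesis unfolding Re_levy_khinchin psi_U_def by simp
qed

lemma psi_L_le_Re_levy_khinchin: "psi_L \<mu> \<xi> \<le> 4 * Re (levy_khinchin a \<mu> \<xi>)"
proof -
  have "(\<integral>u. indicator {u. \<bar>\<xi> * u\<bar> < 1} u * (\<xi> * u)\<^sup>2 \<partial>\<mu>) \<le> (\<integral>u. 4 * (1 - cos (\<xi> * u)) \<partial>\<mu>)"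
  proof (intro integral_mono integrable_psi_L)
    show "indicator {u. \<bar>\<xi> * u\<bar> < 1} u * (\<xi> * u)\<^sup>2 \<le> 4 * (1 - cos (\<xi> * u))" for u
      using quarter_square_le_one_minus_cos[of "\<xi> * u"] by (auto simp: indicator_def)
    show "integrable \<mu> (\<lambda>u. 4 * (1 - cos (\<xi> * u)))"
      by (intro integrable_mult_right integrable_one_minus_cos)
  qed
  then show ?thesis
    unfolding integral_mult_right_zero Re_levy_khinchin psi_L_def set_lebesgue_integral_def by simp
qed

lemma psi_U_mono:
  assumes "\<bar>\<xi>\<bar> \<le> \<bar>\<eta>\<bar>"
  shows "psi_U \<mu> \<xi> \<le> psi_U \<mu> \<eta>"
  unfolding psi_U_def
proof (intro integral_mono integrable_psi_U)
  fix u
  have "(\<xi> * u)\<^sup>2 \<le> (\<eta> * u)\<^sup>2"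
    using assms unfolding abs_le_square_iff[symmetric] abs_mult by (rule mult_right_mono) simp
  then show "min ((\<xi> * u)\<^sup>2) 1 \<le> min ((\<eta> * u)\<^sup>2) 1" by linarith
qed

text \<open>
  Pointwise in \<open>y = \<xi> u\<close>: doubling multiplies \<open>y\<^sup>2\<close> by four as long as \<open>\<bar>2 y\<bar> < 1\<close>, so there the gain is
  \<open>3 y\<^sup>2 = 3/4 (2 y)\<^sup>2\<close>; elsewhere the gain is at least \<open>0\<close>.
\<close>

lemma psi_U_double_minus_psi_U: "3 / 4 * psi_L \<mu> (2 * \<xi>) \<le> psi_U \<mu> (2 * \<xi>) - psi_U \<mu> \<xi>"
proof -
  have "(\<integral>u. 3 / 4 * (indicator {u. \<bar>2 * \<xi> * u\<bar> < 1} u * (2 * \<xi> * u)\<^sup>2) \<partial>\<mu>)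
      \<le> (\<integral>u. min ((2 * \<xi> * u)\<^sup>2) 1 - min ((\<xi> * u)\<^sup>2) 1 \<partial>\<mu>)"
  proof (intro integral_mono Bochner_Integration.integrable_diff integrable_psi_U integrable_mult_right integrable_psi_L)
    fix u
    have "min ((2 * \<xi> * u)\<^sup>2) 1 - min ((\<xi> * u)\<^sup>2) 1 \<ge> 0"
      by (simp add: power_mult_distrib mult.assoc min_def)
    moreover have "(2 * \<xi> * u)\<^sup>2 \<le> 1" if "\<bar>2 * \<xi> * u\<bar> < 1"
      using that by (simp add: abs_square_le_1)
    ultimately show "3 / 4 * (indicator {u. \<bar>2 * \<xi> * u\<bar> < 1} u * (2 * \<xi> * u)\<^sup>2)
        \<le> min ((2 * \<xi> * u)\<^sup>2) 1 - min ((\<xi> * u)\<^sup>2) 1"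
      by (auto simp: indicator_def power_mult_distrib mult.assoc min_def)
  qed
  then show ?thesis
    using integrable_psi_U[of "2 * \<xi>"] integrable_psi_U[of \<xi>]
    unfolding psi_U_def psi_L_def set_lebesgue_integral_def by simp
qed

lemma psi_U_pos:
  assumes "emeasure \<mu> UNIV \<noteq> 0" "\<xi> \<noteq> 0"
  shows "psi_U \<mu> \<xi> > 0"
proof -
  \<comment> \<open>If the integral vanished, \<open>\<mu>\<close> would live on \<open>{0}\<close>, which it does not charge.\<close>
  have "psi_U \<mu> \<xi> \<noteq> 0"
  proof
    assume "psi_U \<mu> \<xi> = 0"
    then have "AE u in \<mu>. min ((\<xi> * u)\<^sup>2) 1 = 0"
      unfolding psi_U_def by (subst (asm) integral_nonneg_eq_0_iff_AE[OF integrable_psi_U]) auto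
    then have "AE u in \<mu>. u = 0"
      by eventually_elim (use assms in \<open>auto simp: min_def split: if_splits\<close>)
    moreover have "AE u in \<mu>. u \<noteq> 0"
      using levy by (intro AE_I[of _ _ "{0}"]) (auto simp: levy_measure_def sets_levy_measure)
    ultimately have "AE u in \<mu>. False" by eventually_elim simp
    then have "emeasure \<mu> (space \<mu>) = 0" by (simp add: AE_iff_null null_setsD1)
    then show False
      using assms sets_eq_imp_space_eq[OF sets_levy_measure] by simp
  qed
  moreover have "psi_U \<mu> \<xi> \<ge> 0" unfolding psi_U_def by (intro Bochner_Integration.integral_nonneg) auto
  ultimately show ?thesis by simp
qed

end

section \<open>Growth of the exponent under condition A\<close>

context
  fixes \<mu> :: "real measure" and \<beta> :: real
  assumes levy: "levy_measure \<mu>"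
    and beta: "\<beta> > 1"
    and cond_A: "\<And>\<xi>. psi_U \<mu> \<xi> \<le> \<beta> * psi_L \<mu> \<xi>"
begin

text \<open>
  This is where condition A acts: the increment of \<open>\<psi>\<^sup>U\<close> under doubling is bounded below by \<open>\<psi>\<^sup>L\<close>, and
  condition A turns this into a fixed fraction of \<open>\<psi>\<^sup>U\<close> itself.
\<close>

lemma psi_U_doubling:
  obtains q where "q > 1" "\<And>\<xi>. q * psi_U \<mu> \<xi> \<le> psi_U \<mu> (2 * \<xi>)"
proof
  have pos: "1 - 3 / (4 * \<beta>) > 0"
    using beta by (simp add: field_simps)
  show "1 / (1 - 3 / (4 * \<beta>)) > 1"
    using beta pos by (simp add: field_simps)
  fix \<xi>
  have "3 / (4 * \<beta>) * psi_U \<mu> (2 * \<xi>) \<le> 3 / (4 * \<beta>) * (\<beta> * psi_L \<mu> (2 * \<xi>))"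
    using beta by (intro mult_left_mono cond_A) auto
  also have "\<dots> = 3 / 4 * psi_L \<mu> (2 * \<xi>)"
    using beta by simp
  also have "\<dots> \<le> psi_U \<mu> (2 * \<xi>) - psi_U \<mu> \<xi>"
    by (rule psi_U_double_minus_psi_U[OF levy])
  finally have "psi_U \<mu> \<xi> \<le> (1 - 3 / (4 * \<beta>)) * psi_U \<mu> (2 * \<xi>)"
    by (simp add: left_diff_distrib)
  then show "1 / (1 - 3 / (4 * \<beta>)) * psi_U \<mu> \<xi> \<le> psi_U \<mu> (2 * \<xi>)"
    using pos by (simp add: pos_divide_le_eq mult.commute)
qed

lemma psi_U_le_Re_levy_khinchin: "psi_U \<mu> \<xi> \<le> 4 * \<beta> * Re (levy_khinchin a \<mu> \<xi>)"
proof -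
  have "psi_U \<mu> \<xi> \<le> \<beta> * psi_L \<mu> \<xi>" by (rule cond_A)
  also have "\<dots> \<le> \<beta> * (4 * Re (levy_khinchin a \<mu> \<xi>))"
    using beta by (intro mult_left_mono psi_L_le_Re_levy_khinchin[OF levy]) auto
  finally show ?thesis by simp
qed

text \<open>
  This makes the set whose infimum is \<open>\<rho>\<^sub>t\<close> nonempty.
\<close>

lemma Re_levy_khinchin_unbounded:
  assumes "emeasure \<mu> UNIV \<noteq> 0"
  shows "\<exists>\<xi>>0. Re (levy_khinchin a \<mu> \<xi>) \<ge> B"
proof -
  obtain q where q: "q > 1" and doubling: "\<And>\<xi>. q * psi_U \<mu> \<xi> \<le> psi_U \<mu> (2 * \<xi>)"
    by (rule psi_U_doubling) blast
  have pos: "psi_U \<mu> 1 > 0"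
    by (rule psi_U_pos[OF levy assms]) simp
  obtain n where n: "4 * \<beta> * B / psi_U \<mu> 1 < q ^ n"
    using real_arch_pow[OF q] by blast
  have "q ^ m * psi_U \<mu> 1 \<le> psi_U \<mu> (2 ^ m)" for m
  proof (induction m)
    case (Suc m)
    have "q ^ Suc m * psi_U \<mu> 1 \<le> q * psi_U \<mu> (2 ^ m)"
      using mult_left_mono[OF Suc, of q] q by (simp add: mult.assoc)
    also have "\<dots> \<le> psi_U \<mu> (2 ^ Suc m)"
      using doubling[of "2 ^ m"] by simp
    finally show ?case .
  qed simp
  then have "4 * \<beta> * B \<le> psi_U \<mu> (2 ^ n)"
    using n pos by (smt (verit) pos_divide_less_eq)
  also have "\<dots> \<le> 4 * \<beta> * Re (levy_khinchin a \<mu> (2 ^ n))"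
    by (rule psi_U_le_Re_levy_khinchin)
  finally have "B \<le> Re (levy_khinchin a \<mu> (2 ^ n))"
    using beta by simp
  then show ?thesis by (intro exI[of _ "2 ^ n"]) simp
qed

text \<open>
  Beyond \<open>r\<close> the quantity \<open>y = t Re \<psi> \<xi>\<close> is at least a constant times \<open>\<psi>\<^sup>U \<xi> / \<psi>\<^sup>U r\<close>, because \<open>t \<psi>\<^sup>U r\<close> is
  bounded below. A power of this ratio dominates \<open>\<bar>\<xi> / r\<bar> ^ k\<close>, and \<open>y ^ N exp (- y) \<le> N!\<close>. The order of
  quantifiers matters: one constant serves all \<open>t\<close> and all \<open>r\<close>.
\<close>

lemma power_mult_exp_Re_levy_khinchin_bounded:
  "\<exists>C. \<forall>a t r \<xi>. t > 0 \<longrightarrow> r > 0 \<longrightarrow> t * Re (levy_khinchin a \<mu> r) \<ge> 1 \<longrightarrow>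
     \<bar>\<xi> / r\<bar> ^ k * exp (- (t * Re (levy_khinchin a \<mu> \<xi>))) \<le> C"
proof -
  obtain q where q: "q > 1" and doubling: "\<And>\<xi>. q * psi_U \<mu> \<xi> \<le> psi_U \<mu> (2 * \<xi>)"
    by (rule psi_U_doubling) blast
  obtain N where N: "2 ^ k < q ^ N"
    using real_arch_pow[OF q] by blast
  define C where "C = max 1 ((q * (8 * \<beta>)) ^ N * fact N)"
  have "\<bar>\<xi> / r\<bar> ^ k * exp (- (t * Re (levy_khinchin a \<mu> \<xi>))) \<le> C"
    if t: "t > 0" and r: "r > 0" and scale: "t * Re (levy_khinchin a \<mu> r) \<ge> 1" for a t r \<xi>
  proof -
    define y where "y = t * Re (levy_khinchin a \<mu> \<xi>)"
    have y: "y \<ge> 0"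
      using t Re_levy_khinchin_nonneg[OF levy] by (simp add: y_def)
    show ?thesis
    proof (cases "\<bar>\<xi>\<bar> < r")
      case True
      then have "\<bar>\<xi> / r\<bar> ^ k * exp (- y) \<le> 1 * 1"
        using r y by (intro mult_mono power_le_one) auto
      then show ?thesis by (simp add: y_def C_def)
    next
      case False
      have "1 \<le> t * (2 * psi_U \<mu> r)"
        using t by (intro order_trans[OF scale mult_left_mono[OF Re_levy_khinchin_le_psi_U[OF levy]]]) simp
      then have psi_r: "1 \<le> 2 * t * psi_U \<mu> r" by simp
      then have psi_r_pos: "psi_U \<mu> r > 0"
        using zero_less_mult_pos[of "2 * t" "psi_U \<mu> r"] t by simp
      have "psi_U \<mu> \<bar>\<xi>\<bar> \<le> psi_U \<mu> \<xi>"
        by (rule psi_U_mono[OF levy]) simp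
      also have "\<dots> \<le> 4 * \<beta> * Re (levy_khinchin a \<mu> \<xi>)"
        by (rule psi_U_le_Re_levy_khinchin)
      also have "\<dots> \<le> 4 * \<beta> * Re (levy_khinchin a \<mu> \<xi>) * (2 * t * psi_U \<mu> r)"
        using mult_left_mono[OF psi_r, of "4 * \<beta> * Re (levy_khinchin a \<mu> \<xi>)"] beta
          Re_levy_khinchin_nonneg[OF levy] by simp
      finally have ratio: "psi_U \<mu> \<bar>\<xi>\<bar> / psi_U \<mu> r \<le> 8 * \<beta> * y"
        using psi_r_pos by (simp add: pos_divide_le_eq y_def mult_ac)
      have nn: "0 \<le> psi_U \<mu> \<bar>\<xi>\<bar> / psi_U \<mu> r"
        using psi_r_pos psi_U_mono[OF levy, of r "\<bar>\<xi>\<bar>"] False r by auto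
      have "\<bar>\<xi> / r\<bar> ^ k = (\<bar>\<xi>\<bar> / r) ^ k"
        using r by simp
      also have "\<dots> \<le> (q * (psi_U \<mu> \<bar>\<xi>\<bar> / psi_U \<mu> r)) ^ N"
        using N q psi_r_pos r False
        by (intro power_growth_of_doubling doubling psi_U_mono[OF levy]) auto
      also have "\<dots> \<le> (q * (8 * \<beta> * y)) ^ N"
        using ratio q mult_nonneg_nonneg[OF _ nn, of q] by (intro power_mono mult_left_mono) auto
      also have "\<dots> = (q * (8 * \<beta>)) ^ N * y ^ N"
        by (simp add: mult.assoc flip: power_mult_distrib)
      finally have "\<bar>\<xi> / r\<bar> ^ k * exp (- y) \<le> (q * (8 * \<beta>)) ^ N * y ^ N * exp (- y)"
        by (rule mult_right_mono) simp
      also have "\<dots> \<le> (q * (8 * \<beta>)) ^ N * fact N"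
        unfolding mult.assoc using beta q
        by (intro mult_left_mono[OF power_mult_exp_minus_le_fact[OF y], unfolded mult.assoc]) auto
      finally show ?thesis by (simp add: C_def y_def)
    qed
  qed
  then show ?thesis by blast
qed

text \<open>
  The powers \<open>n\<close> and \<open>n + 2\<close> of the decay estimate add up to one with the integrable profile
  \<open>1 / (1 + (\<xi> / r)\<^sup>2)\<close>. The case \<open>n = 0\<close> gives the upper bound of the density, the other cases its
  smoothness.
\<close>

lemma moment_exp_Re_levy_khinchin_le:
  "\<exists>C>0. \<forall>a t r \<xi>. t > 0 \<longrightarrow> r > 0 \<longrightarrow> t * Re (levy_khinchin a \<mu> r) \<ge> 1 \<longrightarrow>
     \<bar>\<xi>\<bar> ^ n * exp (- (t * Re (levy_khinchin a \<mu> \<xi>))) \<le> C * r ^ n * (1 / (1 + (\<xi> / r)\<^sup>2))"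
proof -
  obtain C1 where C1: "\<And>a t r \<xi>. t > 0 \<Longrightarrow> r > 0 \<Longrightarrow> t * Re (levy_khinchin a \<mu> r) \<ge> 1 \<Longrightarrow>
     \<bar>\<xi> / r\<bar> ^ n * exp (- (t * Re (levy_khinchin a \<mu> \<xi>))) \<le> C1"
    using power_mult_exp_Re_levy_khinchin_bounded[of n] by metis
  obtain C2 where C2: "\<And>a t r \<xi>. t > 0 \<Longrightarrow> r > 0 \<Longrightarrow> t * Re (levy_khinchin a \<mu> r) \<ge> 1 \<Longrightarrow>
     \<bar>\<xi> / r\<bar> ^ (n + 2) * exp (- (t * Re (levy_khinchin a \<mu> \<xi>))) \<le> C2"
    using power_mult_exp_Re_levy_khinchin_bounded[of "n + 2"] by metis
  define C where "C = max 1 (C1 + C2)"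
  have "\<bar>\<xi>\<bar> ^ n * exp (- (t * Re (levy_khinchin a \<mu> \<xi>))) \<le> C * r ^ n * (1 / (1 + (\<xi> / r)\<^sup>2))"
    if t: "t > 0" and r: "r > 0" and scale: "t * Re (levy_khinchin a \<mu> r) \<ge> 1" for a t r \<xi>
  proof -
    let ?e = "exp (- (t * Re (levy_khinchin a \<mu> \<xi>)))"
    have pos: "1 + (\<xi> / r)\<^sup>2 > 0"
      by (simp add: add_pos_nonneg)
    have distrib: "A * e * (1 + s) = A * e + (A * s) * e" for A e s :: real
      by (simp add: algebra_simps)
    have "\<bar>\<xi> / r\<bar> ^ n * ?e * (1 + (\<xi> / r)\<^sup>2) = \<bar>\<xi> / r\<bar> ^ n * ?e + \<bar>\<xi> / r\<bar> ^ (n + 2) * ?e"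
      using distrib[of "\<bar>\<xi> / r\<bar> ^ n" ?e "(\<xi> / r)\<^sup>2"] by (simp only: power_add power2_abs)
    also have "\<dots> \<le> C"
      using C1[OF that, of \<xi>] C2[OF that, of \<xi>] unfolding C_def by linarith
    finally have "\<bar>\<xi> / r\<bar> ^ n * ?e \<le> C / (1 + (\<xi> / r)\<^sup>2)"
      using pos by (simp add: pos_le_divide_eq)
    then have "r ^ n * (\<bar>\<xi> / r\<bar> ^ n * ?e) \<le> r ^ n * (C / (1 + (\<xi> / r)\<^sup>2))"
      using r by (intro mult_left_mono) auto
    moreover have "\<bar>\<xi>\<bar> ^ n * ?e = r ^ n * (\<bar>\<xi> / r\<bar> ^ n * ?e)"
      using r by (simp add: power_divide)
    moreover have "C * r ^ n * (1 / (1 + (\<xi> / r)\<^sup>2)) = r ^ n * (C / (1 + (\<xi> / r)\<^sup>2))"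
      by simp
    ultimately show ?thesis by (simp only:)
  qed
  moreover have "C > 0" by (simp add: C_def)
  ultimately show ?thesis by blast
qed

end

section \<open>Smooth density and bounds for its maximum\<close>

theorem theorem2p1:
  fixes M :: "'a measure" and Z :: "real \<Rightarrow> 'a \<Rightarrow> real"
    and \<psi> :: "real \<Rightarrow> complex" and a :: real and \<mu> :: "real measure"
  assumes "levy_process M Z"
    and "characteristic_exponent M Z \<psi>"
    and "levy_measure \<mu>"
    and "\<And>\<xi>. \<psi> \<xi> = levy_khinchin a \<mu> \<xi>"
    and "emeasure \<mu> UNIV = \<infinity>"
    and "condition_A \<mu>"
  shows "\<exists>p :: real \<Rightarrow> real \<Rightarrow> real.
    (\<forall>t>0. (\<forall>x. p t x \<ge> 0) \<and> distributed M lborel (Z t) (\<lambda>x. ennreal (p t x)) \<and>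
            infinitely_differentiable (p t)) \<and>
    (\<forall>t\<^sub>0>0. \<exists>c>0. \<exists>d>0. \<forall>t\<in>{0<..t\<^sub>0}. \<exists>m. is_maximum (p t) m \<and>
            c * rho \<psi> t \<le> m \<and> m \<le> d * rho \<psi> t)"
proof -
  interpret levy_process M Z by fact
  obtain \<beta> where beta: "\<beta> > 1" and cond_A: "\<And>\<xi>. psi_U \<mu> \<xi> \<le> \<beta> * psi_L \<mu> \<xi>"
    using \<open>condition_A \<mu>\<close> unfolding condition_A_def by blast
  define N where "N t = distr M borel (Z t)" for t
  \<comment> \<open>The set whose infimum is \<open>\<rho>\<^sub>t\<close>.\<close>
  define S where "S t = {\<xi>. \<xi> > 0 \<and> Re (\<psi> \<xi>) \<ge> 1 / t}" for t
  have N: "real_distribution (N t)" if "t > 0" for t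
    unfolding N_def using random_variable_Z that by (intro real_distribution_distr) auto
  have meas: "char (N t) \<in> borel_measurable borel" if "t > 0" for t
    by (rule real_distribution.char_measurable[OF N[OF that]])
  have cmod_char: "cmod (char (N t) \<xi>) = exp (- (t * Re (\<psi> \<xi>)))" if "t > 0" for t \<xi>
    using \<open>characteristic_exponent M Z \<psi>\<close> that
    unfolding characteristic_exponent_def N_def by simp
  have S_nonempty: "S t \<noteq> {}" for t
    using Re_levy_khinchin_unbounded[OF \<open>levy_measure \<mu>\<close> beta cond_A, where a = a and B = "1 / t"] assms(4,5)
    by (auto simp: S_def)
  have scale: "t * Re (levy_khinchin a \<mu> r) \<ge> 1" if "t > 0" "r \<in> S t" for t r
    using that assms(4) by (simp add: S_def field_simps)

  have moments: "\<exists>C>0. \<forall>t>0. \<forall>r\<in>S t. \<forall>\<xi>.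
      \<bar>\<xi>\<bar> ^ n * cmod (char (N t) \<xi>) \<le> C * r ^ n * (1 / (1 + (\<xi> / r)\<^sup>2))" for n
  proof -
    obtain C where "C > 0" and C: "\<And>t r \<xi>. t > 0 \<Longrightarrow> r > 0 \<Longrightarrow> t * Re (levy_khinchin a \<mu> r) \<ge> 1 \<Longrightarrow>
        \<bar>\<xi>\<bar> ^ n * exp (- (t * Re (levy_khinchin a \<mu> \<xi>))) \<le> C * r ^ n * (1 / (1 + (\<xi> / r)\<^sup>2))"
      using moment_exp_Re_levy_khinchin_le[OF \<open>levy_measure \<mu>\<close> beta cond_A, of n] by metis
    have "\<bar>\<xi>\<bar> ^ n * cmod (char (N t) \<xi>) \<le> C * r ^ n * (1 / (1 + (\<xi> / r)\<^sup>2))"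
      if "t > 0" "r \<in> S t" for t r \<xi>
      unfolding cmod_char[OF \<open>t > 0\<close>] assms(4)
      using that scale[OF that] by (intro C) (auto simp: S_def)
    with \<open>C > 0\<close> show ?thesis by blast
  qed
  have integrable_moment: "integrable lborel (\<lambda>\<xi>. \<bar>\<xi>\<bar> ^ n * cmod (char (N t) \<xi>))" if t: "t > 0" for n t
  proof -
    note [measurable] = meas[OF t]
    obtain r where r: "r \<in> S t" using S_nonempty by blast
    then have "r > 0" by (simp add: S_def)
    obtain C where C: "\<And>\<xi>. \<bar>\<xi>\<bar> ^ n * cmod (char (N t) \<xi>) \<le> C * r ^ n * (1 / (1 + (\<xi> / r)\<^sup>2))"
      using moments[of n] t r by blast
    show ?thesis
    proof (rule Bochner_Integration.integrable_bound)
      show "integrable lborel (\<lambda>\<xi>. C * r ^ n * (1 / (1 + (\<xi> / r)\<^sup>2)))"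
        by (intro integrable_mult_right integrable_inverse_1_plus_square_scaled \<open>r > 0\<close>)
      show "AE \<xi> in lborel. norm (\<bar>\<xi>\<bar> ^ n * cmod (char (N t) \<xi>)) \<le> norm (C * r ^ n * (1 / (1 + (\<xi> / r)\<^sup>2)))"
      proof (intro AE_I2)
        fix \<xi>
        have "norm (\<bar>\<xi>\<bar> ^ n * cmod (char (N t) \<xi>)) = \<bar>\<xi>\<bar> ^ n * cmod (char (N t) \<xi>)"
          by (simp add: abs_mult)
        also note C[of \<xi>]
        also have "C * r ^ n * (1 / (1 + (\<xi> / r)\<^sup>2)) \<le> norm (C * r ^ n * (1 / (1 + (\<xi> / r)\<^sup>2)))"
          by (simp only: real_norm_def abs_ge_self)
        finally show "norm (\<bar>\<xi>\<bar> ^ n * cmod (char (N t) \<xi>)) \<le> norm (C * r ^ n * (1 / (1 + (\<xi> / r)\<^sup>2)))" .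
      qed
    qed simp
  qed
  have char: "integrable lborel (char (N t))" if "t > 0" for t
    using integrable_moment[OF that, of 0] meas[OF that] by (simp add: integrable_norm_iff)
  have char1: "integrable lborel (\<lambda>\<xi>. \<bar>\<xi>\<bar> * cmod (char (N t) \<xi>))" if "t > 0" for t
    using integrable_moment[OF that, of 1] by simp

  define p where "p t = inverse_fourier (char (N t))" for t
  have smooth: "infinitely_differentiable (p t)" if "t > 0" for t
    unfolding p_def
    by (rule infinitely_differentiable_inverse_fourier[OF meas[OF that] integrable_moment[OF that]])
  have cont: "continuous_on UNIV (p t)" if "t > 0" for t
    using smooth[OF that] unfolding infinitely_differentiable_def
    by (intro continuous_at_imp_continuous_on ballI field_differentiable_imp_continuous_at)
       (metis funpow_0)
  have nonneg: "p t x \<ge> 0" if "t > 0" for t x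
    unfolding p_def
    by (rule real_distribution.inverse_fourier_char_nonneg[OF N char char1]) (use that in auto)
  have density: "distributed M lborel (Z t) (\<lambda>x. ennreal (p t x))" if t: "t > 0" for t
  proof (rule distributedI_borel_atMost)
    show Zt: "Z t \<in> borel_measurable M"
      using random_variable_Z t by simp
    show mp: "p t \<in> borel_measurable borel"
      using cont[OF t] by (rule borel_measurable_continuous_onI)
    show "AE x in lborel. 0 \<le> p t x"
      using nonneg[OF t] by simp
    show "(\<integral>\<^sup>+x. ennreal (p t x * indicator {..b} x) \<partial>lborel) = ennreal (cdf (N t) b)" for b
    proof -
      have "ennreal (p t x * indicator {..b} x) = ennreal (p t x) * indicator {..b} x" for x
        by (simp split: split_indicator)
      then show ?thesis
        using real_distribution.nn_integral_atMost_inverse_fourier_char[OF N[OF t] char[OF t] char1[OF t]] mp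
        by (simp add: p_def)
    qed
    show "emeasure M {\<omega> \<in> space M. Z t \<omega> \<le> b} = ennreal (cdf (N t) b)" for b
    proof -
      have "Z t -` {..b} \<inter> space M = {\<omega> \<in> space M. Z t \<omega> \<le> b}" by auto
      then show ?thesis
        unfolding cdf_def N_def using Zt by (simp add: measure_distr emeasure_eq_measure)
    qed
  qed

  obtain C where "C > 0" and C: "\<And>t r \<xi>. t > 0 \<Longrightarrow> r \<in> S t \<Longrightarrow>
      cmod (char (N t) \<xi>) \<le> C * (1 / (1 + (\<xi> / r)\<^sup>2))"
    using moments[of 0] by auto
  \<comment> \<open>The bound holds at every scale \<open>r\<close> in \<open>S t\<close>, so the infimum may be taken without knowing that it is attained or positive.\<close>
  have upper: "p t x \<le> C / 2 * rho \<psi> t" if t: "t > 0" for t x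
  proof -
    have "p t x / (C / 2) \<le> r" if r: "r \<in> S t" for r
    proof -
      have "r > 0" using r by (simp add: S_def)
      have "p t x \<le> 1 / (2 * pi) * (LBINT \<xi>. cmod (char (N t) \<xi>))"
        unfolding p_def using abs_inverse_fourier_le[OF char[OF t]] abs_ge_self order_trans by blast
      also have "\<dots> \<le> 1 / (2 * pi) * (LBINT \<xi>. C * (1 / (1 + (\<xi> / r)\<^sup>2)))"
        using integrable_inverse_1_plus_square_scaled[OF \<open>r > 0\<close>] char[OF t] C[OF t r]
        by (intro mult_left_mono integral_mono integrable_mult_right integrable_norm) auto
      also have "\<dots> = C / 2 * r"
        unfolding integral_mult_right_zero integral_inverse_1_plus_square_scaled[OF \<open>r > 0\<close>] by simp
      finally show ?thesis using \<open>C > 0\<close> by (simp add: field_simps)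
    qed
    then have "p t x / (C / 2) \<le> rho \<psi> t"
      unfolding rho_def S_def[symmetric] by (intro cInf_greatest S_nonempty)
    then show ?thesis using \<open>C > 0\<close> by (simp add: field_simps)
  qed

  \<comment> \<open>The maximum is at least the mean of \<open>p t\<close> under the distribution of \<open>Z t\<close>, and \<open>\<bar>\<phi>\<^sub>t\<bar>\<^sup>2 \<ge> exp (- 2)\<close> to the left of \<open>\<rho>\<^sub>t\<close>.\<close>
  have lower: "exp (- 2) / (2 * pi) * rho \<psi> t \<le> m" if t: "t > 0" and m: "is_maximum (p t) m" for t m
  proof -
    interpret N: real_distribution "N t" by (rule N[OF t])
    note [measurable] = meas[OF t]
    have rho_nonneg: "rho \<psi> t \<ge> 0"
      unfolding rho_def S_def[symmetric] by (intro cInf_greatest S_nonempty) (simp add: S_def)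
    have below: "exp (- 2) \<le> (cmod (char (N t) \<xi>))\<^sup>2" if "\<xi> \<in> {0<..<rho \<psi> t}" for \<xi>
    proof -
      have "\<xi> \<notin> S t"
      proof
        assume "\<xi> \<in> S t"
        then have "rho \<psi> t \<le> \<xi>"
          unfolding rho_def S_def[symmetric] by (rule cInf_lower) (auto simp: S_def intro!: bdd_belowI[of _ 0])
        with that show False by simp
      qed
      then have "t * Re (\<psi> \<xi>) < 1"
        using that t by (simp add: S_def field_simps)
      then have "exp (- 2) \<le> exp (2 * - (t * Re (\<psi> \<xi>)))" by simp
      then show ?thesis
        unfolding cmod_char[OF t] exp_double .
    qed
    have int2: "integrable lborel (\<lambda>\<xi>. (cmod (char (N t) \<xi>))\<^sup>2)"
    proof (rule Bochner_Integration.integrable_bound[OF char[OF t]])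
      show "AE \<xi> in lborel. norm ((cmod (char (N t) \<xi>))\<^sup>2) \<le> norm (char (N t) \<xi>)"
        using N.cmod_char_le_1 by (intro AE_I2) (simp add: power2_eq_square mult_left_le)
    qed simp
    have "exp (- 2) * rho \<psi> t = (LBINT \<xi>. exp (- 2) * indicator {0<..<rho \<psi> t} \<xi>)"
      using rho_nonneg by simp
    also have "\<dots> \<le> (LBINT \<xi>. (cmod (char (N t) \<xi>))\<^sup>2)"
      using int2 below rho_nonneg
      by (intro integral_mono integrable_mult_right integrable_real_indicator) (auto simp: indicator_def)
    finally have "exp (- 2) / (2 * pi) * rho \<psi> t \<le> 1 / (2 * pi) * (LBINT \<xi>. (cmod (char (N t) \<xi>))\<^sup>2)"
      by (simp add: divide_right_mono)
    also have "\<dots> = (\<integral>x. p t x \<partial>N t)"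
      unfolding p_def by (rule N.expectation_inverse_fourier_char[OF char[OF t], symmetric])
    also have "\<dots> \<le> (\<integral>x. m \<partial>N t)"
      using m nonneg[OF t] unfolding is_maximum_def
      by (intro integral_mono_AE') (auto intro: order_trans[OF nonneg[OF t]])
    also have "\<dots> = m" using N.prob_space by simp
    finally show ?thesis .
  qed

  have max: "\<exists>m. is_maximum (p t) m" if "t > 0" for t
    unfolding p_def
    by (rule real_distribution.inverse_fourier_char_has_maximum[OF N char char1])
       (use that cont[unfolded p_def] in auto)
  have bounds: "\<exists>m. is_maximum (p t) m \<and> exp (- 2) / (2 * pi) * rho \<psi> t \<le> m \<and> m \<le> C / 2 * rho \<psi> t"
    if "t > 0" for t
    using max[OF that] lower[OF that] upper[OF that] unfolding is_maximum_def by metis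
  show ?thesis
  proof (intro exI[of _ p] conjI allI impI)
    fix t\<^sub>0 :: real
    show "\<exists>c>0. \<exists>d>0. \<forall>t\<in>{0<..t\<^sub>0}. \<exists>m. is_maximum (p t) m \<and> c * rho \<psi> t \<le> m \<and> m \<le> d * rho \<psi> t"
    proof (rule exI[of _ "exp (- 2) / (2 * pi)"], rule conjI, simp, rule exI[of _ "C / 2"], intro conjI ballI)
      show "C / 2 > 0" using \<open>C > 0\<close> by simp
    qed (use bounds in auto)
  qed (use nonneg density smooth in auto)
qed

end
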